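(* Let $U\subset\mathbb{R}^2$ be an open set with coordinates $(u,v)$, and let $\ell=\ell(v)$ and $f=f(v)$ be any smooth real-valued functions on $U$ depending on the variable $v$ alone. Consider the following system of PDEs for a smooth map $\mathbf{x}(u,v)$ into $\mathbb{A}^3$ and smooth vector-valued functions $\mathbf{e}_1(u,v),\mathbf{e}_2(u,v),\mathbf{e}_3(u,v)$ with values in $\mathbb{R}^3$ such that $(\mathbf{e}_1,\mathbf{e}_2,\mathbf{e}_3)$ is a unimodular frame at each point: $$ \begin{aligned} \mathbf{x}_u&=\mathbf{e}_1, & \mathbf{x}_v&=\mathbf{e}_2,\\ (\mathbf{e}_1)_u&=0, & (\mathbf{e}_1)_v&=\mathbf{e}_3,\\ (\mathbf{e}_2)_u&=\mathbf{e}_3, & (\mathbf{e}_2)_v&=\bigl(u\,\ell(v)+f(v)\bigr)\,\mathbf{e}_1,\\ (\mathbf{e}_3)_u&=0, & (\mathbf{e}_3)_v&=\ell(v)\,\mathbf{e}_1 . \end{aligned} \qquad ( * ) $$ Then for any point $(u_0,v_0)\in U$ there exists a connected open neighborhood $V\subset U$ of $(u_0,v_0)$ on which the system $( * )$ has a smooth solution $(\mathbf{x},\mathbf{e}_1,\mathbf{e}_2,\mathbf{e}_3)$, and this solution defines a parametrization $\mathbf{x}:V\to\mathbb{A}^3$ of a hyperbolic affine flat, affine minimal surface $\Sigma=\mathbf{x}(V)\subset\mathbb{A}^3$. Moreover, the surface $\Sigma=\mathbf{x}(V)$ is uniquely determined up to equiaffine transformations: if $(\mathbf{x},\mathbf{e}_1,\mathbf{e}_2,\mathbf{e}_3)$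 and $(\hat{\mathbf{x}},\hat{\mathbf{e}}_1,\hat{\mathbf{e}}_2,\hat{\mathbf{e}}_3)$ are two solutions of $( * )$ on $V$, then there is an equiaffine transformation $\phi$ of $\mathbb{A}^3$ with $\hat{\mathbf{x}}(V)=\phi(\mathbf{x}(V))$.
   Context: Equiaffine space $\mathbb{A}^3$ is the vector space $\mathbb{R}^3$ together with a fixed nondegenerate (constant) volume form $dV:\Lambda^3\mathbb{R}^3\to\mathbb{R}$ (for which the standard basis has volume $1$). An equiaffine transformation is a map $\phi(\mathbf{x})=A\mathbf{x}+\mathbf{b}$ with $A\in SL(3,\mathbb{R})$, $\mathbf{b}\in\mathbb{R}^3$. A unimodular frame is a basis $(\mathbf{e}_1,\mathbf{e}_2,\mathbf{e}_3)$ with $dV(\mathbf{e}_1,\mathbf{e}_2,\mathbf{e}_3)=1$. Let $\Sigma\subset\mathbb{A}^3$ be a (smooth) regular surface. A (local) unimodular frame field $(\mathbf{e}_1,\mathbf{e}_2,\mathbf{e}_3)$ on $\Sigma$ has associated 1-forms $\omega^i,\omega^i_j$ on $\Sigma$ defined by $d\mathbf{x}=\sum_i\mathbf{e}_i\,\omega^i$ and $d\mathbf{e}_j=\sum_i\mathbf{e}_i\,\omega^i_j$, $1\le i,j\le 3$. 0-adapted: the frame field is 0-adapted if $\mathbf{e}_1,\mathbf{e}_2$ span the tangent plane of $\Sigma$ at each point. Then $\omega^3=0$, $\omega^1,\omega^2$ are linearly independent, and there are functions $h_{ij}=h_{ji}$ with $\omega^3_i=h_{i1}\omega^1+h_{i2}\omega^2$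 ($i=1,2$). The sign of $\det[h_{ij}]$ does not depend on the choice of 0-adapted frame field. $\Sigma$ is hyperbolic if $\det[h_{ij}]<0$ at every point of $\Sigma$. 1-adapted: for hyperbolic $\Sigma$, a 0-adapted frame field is 1-adapted if $h_{11}=h_{22}=0$ and $h_{12}=1$, i.e. $\omega^3_1=\omega^2$ and $\omega^3_2=\omega^1$. Such frame fields exist locally. The affine first fundamental form of $\Sigma$ is $\mathrm{I}_{\mathrm{aff}}=\omega^3_1\circ\omega^1+\omega^3_2\circ\omega^2=2\,\omega^1\circ\omega^2$ (symmetric product), a Lorentzian metric on $\Sigma$. The affine Gauss curvature $K_{\mathrm{aff}}$ is the Gauss curvature of the metric $\mathrm{I}_{\mathrm{aff}}$. 2-adapted: a 1-adapted frame field is 2-adapted if $\omega^3_3=0$. Such frame fields exist locally. For a 2-adapted frame field there are functions $\ell_{11},\ell_{12},\ell_{22}$ with $\omega^1_3=\ell_{12}\omega^1+\ell_{22}\omega^2$ and $\omega^2_3=\ell_{11}\omega^1+\ell_{12}\omega^2$. The affine mean curvature is $H_{\mathrm{aff}}=\ell_{12}$. The conditions $K_{\mathrm{aff}}\equiv 0$ and $H_{\mathrm{aff}}\equiv 0$ do not depend on the choices of adapted frame fields. A hyperbolic surface $\Sigma$ is affine flat if $K_{\mathrm{aff}}\equiv 0$ on $\Sigma$, and affine minimal if $H_{\mathrm{aff}}\equiv 0$ on $\Sigma$. A parametrization of a regular surface $\Sigma$ means a smooth regular map (immersion) from an open set of $\mathbb{R}^2$ that is a diffeomorphism onto $\Sigma$.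 Subscripts $u,v$ on functions denote partial derivatives. *)

theory Defs
  imports "HOL-Analysis.Analysis"
begin

text \<open>C-infinity maps; meant for open sets \<open>S\<close>, where all iterated directional derivatives exist.\<close>

primrec Ck_on :: "nat \<Rightarrow> 'a set \<Rightarrow> ('a::real_normed_vector \<Rightarrow> 'b::real_normed_vector) \<Rightarrow> bool" where
  "Ck_on 0 S f \<longleftrightarrow> continuous_on S f"
| "Ck_on (Suc k) S f \<longleftrightarrow>
     (\<forall>p\<in>S. f differentiable at p) \<and> (\<forall>w. Ck_on k S (\<lambda>p. frechet_derivative f (at p) w))"

definition smooth_on :: "'a set \<Rightarrow> ('a::real_normed_vector \<Rightarrow> 'b::real_normed_vector) \<Rightarrow> bool" where
  "smooth_on S f \<longleftrightarrow> (\<forall>k. Ck_on k S f)"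

definition coord_vec :: "2 \<Rightarrow> real \<times> real" where
  "coord_vec i = (if i = 1 then (1, 0) else (0, 1))"

definition partial_deriv :: "2 \<Rightarrow> (real \<times> real \<Rightarrow> 'b::real_normed_vector) \<Rightarrow> real \<times> real \<Rightarrow> 'b" where
  "partial_deriv i F q = frechet_derivative F (at q) (coord_vec i)"

abbreviation "partial_u \<equiv> partial_deriv 1"
abbreviation "partial_v \<equiv> partial_deriv 2"


section \<open>Equiaffine space\<close>

definition dV :: "real^3 \<Rightarrow> real^3 \<Rightarrow> real^3 \<Rightarrow> real" where
  "dV a b c = det (vector [a, b, c] :: real^3^3)"

definition equiaffine :: "(real^3 \<Rightarrow> real^3) \<Rightarrow> bool" where
  "equiaffine \<phi> \<longleftrightarrow> (\<exists>(A::real^3^3) b. det A = 1 \<and> (\<forall>x. \<phi> x = A *v x + b))"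


section \<open>Regular surfaces\<close>

definition immersion_on :: "(real \<times> real) set \<Rightarrow> (real \<times> real \<Rightarrow> real^3) \<Rightarrow> bool" where
  "immersion_on W X \<longleftrightarrow> smooth_on W X \<and> (\<forall>q\<in>W. inj (frechet_derivative X (at q)))"

text \<open>A local parametrization of the subset \<open>\<Sigma>\<close> (an inverse chart).\<close>

definition local_param ::
  "(real^3) set \<Rightarrow> (real \<times> real) set \<Rightarrow> (real \<times> real \<Rightarrow> real^3) \<Rightarrow> bool" where
  "local_param \<Sigma> W X \<longleftrightarrow> open W \<and> immersion_on W X
     \<and> openin (top_of_set \<Sigma>) (X ` W) \<and> (\<exists>Y. homeomorphism W (X ` W) X Y)"

definition regular_surface :: "(real^3) set \<Rightarrow> bool" where
  "regular_surface \<Sigma> \<longleftrightarrow> (\<forall>p\<in>\<Sigma>. \<exists>W X. local_param \<Sigma> W X \<and> p \<in> X ` W)"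

text \<open>Smoothness of a map defined on a regular surface, tested in a local parametrization around
  each point; transition maps being smooth, the choice of local parametrizations is immaterial.\<close>

definition smooth_on_surface :: "(real^3) set \<Rightarrow> (real^3 \<Rightarrow> 'b::real_normed_vector) \<Rightarrow> bool" where
  "smooth_on_surface \<Sigma> g \<longleftrightarrow>
     (\<forall>p\<in>\<Sigma>. \<exists>W X. local_param \<Sigma> W X \<and> p \<in> X ` W \<and> smooth_on W (g \<circ> X))"

definition parametrization ::
  "(real^3) set \<Rightarrow> (real \<times> real) set \<Rightarrow> (real \<times> real \<Rightarrow> real^3) \<Rightarrow> bool" where
  "parametrization \<Sigma> V x \<longleftrightarrow> regular_surface \<Sigma> \<and> open V \<and> immersion_on V x
     \<and> bij_betw x V \<Sigma> \<and> smooth_on_surface \<Sigma> (inv_into V x)"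


section \<open>Frame fields and their structure forms\<close>

text \<open>Frame fields on the open piece \<open>X ` W\<close> of a surface, and the associated 1-forms, are pulled
  back to \<open>W\<close> by the local parametrization \<open>X\<close>: a frame field is a family
  \<open>e :: 3 \<Rightarrow> real \<times> real \<Rightarrow> real^3\<close>, and a 1-form maps a point of \<open>W\<close> and a vector of the plane to a
  real number.\<close>

definition unimodular_at :: "(3 \<Rightarrow> real \<times> real \<Rightarrow> real^3) \<Rightarrow> real \<times> real \<Rightarrow> bool" where
  "unimodular_at e q \<longleftrightarrow> dV (e 1 q) (e 2 q) (e 3 q) = 1"

definition frame_coords :: "(3 \<Rightarrow> real \<times> real \<Rightarrow> real^3) \<Rightarrow> real \<times> real \<Rightarrow> real^3 \<Rightarrow> real^3" where
  "frame_coords e q y = (THE c. y = (\<Sum>i\<in>UNIV. (c $ i) *\<^sub>R e i q))"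

text \<open>\<open>dual_form X e i\<close> and \<open>conn_form e i j\<close> are the forms \<open>\<omega>\<^sup>i\<close> and \<open>\<omega>\<^sup>i\<^sub>j\<close> (upper index first) of
  \<open>dx = \<Sum>\<^sub>i e\<^sub>i \<omega>\<^sup>i\<close> and \<open>de\<^sub>j = \<Sum>\<^sub>i e\<^sub>i \<omega>\<^sup>i\<^sub>j\<close>.\<close>

definition dual_form :: "(real \<times> real \<Rightarrow> real^3) \<Rightarrow> (3 \<Rightarrow> real \<times> real \<Rightarrow> real^3)
    \<Rightarrow> 3 \<Rightarrow> real \<times> real \<Rightarrow> real \<times> real \<Rightarrow> real" where
  "dual_form X e i q w = frame_coords e q (frechet_derivative X (at q) w) $ i"

definition conn_form :: "(3 \<Rightarrow> real \<times> real \<Rightarrow> real^3)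
    \<Rightarrow> 3 \<Rightarrow> 3 \<Rightarrow> real \<times> real \<Rightarrow> real \<times> real \<Rightarrow> real" where
  "conn_form e i j q w = frame_coords e q (frechet_derivative (e j) (at q) w) $ i"

definition zero_adapted :: "(real \<times> real) set \<Rightarrow> (real \<times> real \<Rightarrow> real^3)
    \<Rightarrow> (3 \<Rightarrow> real \<times> real \<Rightarrow> real^3) \<Rightarrow> bool" where
  "zero_adapted W X e \<longleftrightarrow> (\<forall>i. smooth_on W (e i)) \<and>
     (\<forall>q\<in>W. unimodular_at e q \<and> span {e 1 q, e 2 q} = range (frechet_derivative X (at q)))"

text \<open>The matrix \<open>[h\<^sub>i\<^sub>j]\<close>, with \<open>\<omega>\<^sup>3\<^sub>i = h\<^sub>i\<^sub>1 \<omega>\<^sup>1 + h\<^sub>i\<^sub>2 \<omega>\<^sup>2\<close>. It is determined by these equations for a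
  0-adapted frame field; its symmetry then follows from the structure equations.\<close>

definition h_matrix :: "(real \<times> real \<Rightarrow> real^3) \<Rightarrow> (3 \<Rightarrow> real \<times> real \<Rightarrow> real^3)
    \<Rightarrow> real \<times> real \<Rightarrow> real^2^2" where
  "h_matrix X e q = (THE h. \<forall>w.
       conn_form e 3 1 q w = h$1$1 * dual_form X e 1 q w + h$1$2 * dual_form X e 2 q w \<and>
       conn_form e 3 2 q w = h$2$1 * dual_form X e 1 q w + h$2$2 * dual_form X e 2 q w)"

definition one_adapted :: "(real \<times> real) set \<Rightarrow> (real \<times> real \<Rightarrow> real^3)
    \<Rightarrow> (3 \<Rightarrow> real \<times> real \<Rightarrow> real^3) \<Rightarrow> bool" where
  "one_adapted W X e \<longleftrightarrow> zero_adapted W X e \<and>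
     (\<forall>q\<in>W. h_matrix X e q $ 1 $ 1 = 0 \<and> h_matrix X e q $ 2 $ 2 = 0 \<and>
            h_matrix X e q $ 1 $ 2 = 1 \<and> h_matrix X e q $ 2 $ 1 = 1)"

definition two_adapted :: "(real \<times> real) set \<Rightarrow> (real \<times> real \<Rightarrow> real^3)
    \<Rightarrow> (3 \<Rightarrow> real \<times> real \<Rightarrow> real^3) \<Rightarrow> bool" where
  "two_adapted W X e \<longleftrightarrow> one_adapted W X e \<and> (\<forall>q\<in>W. \<forall>w. conn_form e 3 3 q w = 0)"


section \<open>Gauss curvature of a metric in the coordinates \<open>(u, v)\<close>\<close>

text \<open>For a nondegenerate symmetric matrix field \<open>g\<close> (of any signature). \<open>christoffel g k i j\<close> is
  \<open>\<Gamma>\<^sup>k\<^sub>i\<^sub>j\<close>, and \<open>curv_vec g k\<close> is the \<open>k\<close>-th component of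
  \<open>R(\<partial>\<^sub>1, \<partial>\<^sub>2) \<partial>\<^sub>2 = \<nabla>\<^sub>1 \<nabla>\<^sub>2 \<partial>\<^sub>2 - \<nabla>\<^sub>2 \<nabla>\<^sub>1 \<partial>\<^sub>2\<close>; the sign makes round spheres positively curved.\<close>

definition christoffel :: "(real \<times> real \<Rightarrow> real^2^2) \<Rightarrow> 2 \<Rightarrow> 2 \<Rightarrow> 2 \<Rightarrow> real \<times> real \<Rightarrow> real" where
  "christoffel g k i j q = (\<Sum>m\<in>UNIV. matrix_inv (g q) $ k $ m *
     (partial_deriv i (\<lambda>p. g p $ j $ m) q + partial_deriv j (\<lambda>p. g p $ i $ m) q
      - partial_deriv m (\<lambda>p. g p $ i $ j) q)) / 2"

definition curv_vec :: "(real \<times> real \<Rightarrow> real^2^2) \<Rightarrow> 2 \<Rightarrow> real \<times> real \<Rightarrow> real" where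
  "curv_vec g k q = partial_deriv 1 (christoffel g k 2 2) q - partial_deriv 2 (christoffel g k 1 2) q
     + (\<Sum>m\<in>UNIV. christoffel g m 2 2 q * christoffel g k 1 m q
                 - christoffel g m 1 2 q * christoffel g k 2 m q)"

definition gauss_curvature :: "(real \<times> real \<Rightarrow> real^2^2) \<Rightarrow> real \<times> real \<Rightarrow> real" where
  "gauss_curvature g q = (\<Sum>k\<in>UNIV. g q $ k $ 1 * curv_vec g k q) / det (g q)"


section \<open>Affine invariants\<close>

definition sym_prod :: "('a \<Rightarrow> real) \<Rightarrow> ('a \<Rightarrow> real) \<Rightarrow> 'a \<Rightarrow> 'a \<Rightarrow> real" where
  "sym_prod \<alpha> \<beta> w z = (\<alpha> w * \<beta> z + \<alpha> z * \<beta> w) / 2"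

definition I_aff :: "(real \<times> real \<Rightarrow> real^3) \<Rightarrow> (3 \<Rightarrow> real \<times> real \<Rightarrow> real^3)
    \<Rightarrow> real \<times> real \<Rightarrow> real \<times> real \<Rightarrow> real \<times> real \<Rightarrow> real" where
  "I_aff X e q w z = sym_prod (conn_form e 3 1 q) (dual_form X e 1 q) w z
                   + sym_prod (conn_form e 3 2 q) (dual_form X e 2 q) w z"

definition K_aff :: "(real \<times> real \<Rightarrow> real^3) \<Rightarrow> (3 \<Rightarrow> real \<times> real \<Rightarrow> real^3)
    \<Rightarrow> real \<times> real \<Rightarrow> real" where
  "K_aff X e = gauss_curvature (\<lambda>q. \<chi> i j. I_aff X e q (coord_vec i) (coord_vec j))"

text \<open>\<open>H_aff\<close> is the coefficient \<open>\<ell>\<^sub>1\<^sub>2\<close> in \<open>\<omega>\<^sup>1\<^sub>3 = \<ell>\<^sub>1\<^sub>2 \<omega>\<^sup>1 + \<ell>\<^sub>2\<^sub>2 \<omega>\<^sup>2\<close>, \<open>\<omega>\<^sup>2\<^sub>3 = \<ell>\<^sub>1\<^sub>1 \<omega>\<^sup>1 + \<ell>\<^sub>1\<^sub>2 \<omega>\<^sup>2\<close>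
  for a 2-adapted frame field.\<close>

definition H_aff :: "(real \<times> real \<Rightarrow> real^3) \<Rightarrow> (3 \<Rightarrow> real \<times> real \<Rightarrow> real^3)
    \<Rightarrow> real \<times> real \<Rightarrow> real" where
  "H_aff X e q = (THE l12. \<exists>l11 l22. \<forall>w.
       conn_form e 1 3 q w = l12 * dual_form X e 1 q w + l22 * dual_form X e 2 q w \<and>
       conn_form e 2 3 q w = l11 * dual_form X e 1 q w + l12 * dual_form X e 2 q w)"

text \<open>The conditions below do not depend on the adapted frame fields (nor on the local
  parametrizations): the sign of \<open>det [h\<^sub>i\<^sub>j]\<close> is invariant, and \<open>K_aff\<close> and \<open>H_aff\<close> are invariant up
  to a common sign (replacing \<open>(e\<^sub>1, e\<^sub>2, e\<^sub>3)\<close> by \<open>(e\<^sub>1, -e\<^sub>2, -e\<^sub>3)\<close> reverses both). So they are tested on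
  some adapted frame field around each point.\<close>

definition hyperbolic_surface :: "(real^3) set \<Rightarrow> bool" where
  "hyperbolic_surface \<Sigma> \<longleftrightarrow> regular_surface \<Sigma> \<and>
     (\<forall>p\<in>\<Sigma>. \<exists>W X e. local_param \<Sigma> W X \<and> p \<in> X ` W \<and> zero_adapted W X e
        \<and> (\<forall>q\<in>W. det (h_matrix X e q) < 0))"

definition affine_flat :: "(real^3) set \<Rightarrow> bool" where
  "affine_flat \<Sigma> \<longleftrightarrow>
     (\<forall>p\<in>\<Sigma>. \<exists>W X e. local_param \<Sigma> W X \<and> p \<in> X ` W \<and> one_adapted W X e
        \<and> (\<forall>q\<in>W. K_aff X e q = 0))"

definition affine_minimal :: "(real^3) set \<Rightarrow> bool" where
  "affine_minimal \<Sigma> \<longleftrightarrow>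
     (\<forall>p\<in>\<Sigma>. \<exists>W X e. local_param \<Sigma> W X \<and> p \<in> X ` W \<and> two_adapted W X e
        \<and> (\<forall>q\<in>W. H_aff X e q = 0))"


section \<open>The system of PDEs\<close>

definition solution_on :: "(real \<Rightarrow> real) \<Rightarrow> (real \<Rightarrow> real) \<Rightarrow> (real \<times> real) set
    \<Rightarrow> (real \<times> real \<Rightarrow> real^3) \<Rightarrow> (3 \<Rightarrow> real \<times> real \<Rightarrow> real^3) \<Rightarrow> bool" where
  "solution_on l f V x e \<longleftrightarrow>
     smooth_on V x \<and> (\<forall>i. smooth_on V (e i)) \<and>
     (\<forall>u v. (u, v) \<in> V \<longrightarrow>
        unimodular_at e (u, v) \<and>
        partial_u x (u, v) = e 1 (u, v) \<and>
        partial_v x (u, v) = e 2 (u, v) \<and>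
        partial_u (e 1) (u, v) = 0 \<and>
        partial_v (e 1) (u, v) = e 3 (u, v) \<and>
        partial_u (e 2) (u, v) = e 3 (u, v) \<and>
        partial_v (e 2) (u, v) = (u * l v + f v) *\<^sub>R e 1 (u, v) \<and>
        partial_u (e 3) (u, v) = 0 \<and>
        partial_v (e 3) (u, v) = l v *\<^sub>R e 1 (u, v))"

end

theory Submission
  imports Defs
begin

text \<open>The system says that the frame moves by \<open>dx = e\<^sub>1 du + e\<^sub>2 dv\<close>, \<open>de\<^sub>1 = e\<^sub>3 dv\<close>,
  \<open>de\<^sub>2 = e\<^sub>3 du + (u l + f) e\<^sub>1 dv\<close>, \<open>de\<^sub>3 = l e\<^sub>1 dv\<close>. Consequently \<open>e\<^sub>1\<close> and \<open>e\<^sub>3\<close> depend on \<open>v\<close> only, and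
  the general solution is \<open>x = g(v) + u p(v)\<close> with \<open>p'' = l p\<close> and \<open>g'' = f p\<close>: a ruled surface
  governed by linear ordinary differential equations.

  Existence: near \<open>v\<^sub>0\<close> the linear system for \<open>(g, p, g', p')\<close> is solved by the contraction principle
  (\<open>picard_lindeloef\<close>); its determinant \<open>dV p g' p'\<close> is conserved, so the resulting frame is
  unimodular (\<open>moving_frame_exists\<close>). The right-hand sides of the frame equations are products of
  the frame itself with smooth coefficients, hence differentiable solutions are automatically smooth.

  Geometry: the forms of any solution can be read off from the equations:
  \<open>\<omega>\<^sup>1 = du\<close>, \<open>\<omega>\<^sup>2 = dv\<close>, \<open>\<omega>\<^sup>3\<^sub>1 = dv\<close>, \<open>\<omega>\<^sup>3\<^sub>2 = du\<close>, \<open>\<omega>\<^sup>3\<^sub>3 = 0\<close>, \<open>\<omega>\<^sup>1\<^sub>3 = l dv\<close>, \<open>\<omega>\<^sup>2\<^sub>3 = 0\<close>. So the frame is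
  2-adapted, the metric is the constant form \<open>2 du dv\<close>, whose curvature vanishes, and \<open>\<ell>\<^sub>1\<^sub>2 = 0\<close>.
  That \<open>x\<close> is an embedding, and not just an immersion, comes from the covector
  \<open>y \<mapsto> dV e\<^sub>1 y e\<^sub>3\<close>: it is constant and equals \<open>v\<close> on the surface up to an additive
  constant, so \<open>v\<close> is an affine function of the point, and then \<open>u\<close> is its coordinate along the
  ruling (\<open>homeomorphism_onto_image\<close>).

  Uniqueness: two frames that satisfy the same equations \<open>dF = F \<Omega>\<close> differ by the constant matrix
  \<open>F' (inverse F)\<close>, so the surfaces differ by an equiaffine transformation (\<open>congruent\<close>).\<close>

section \<open>Calculus of smooth maps\<close>

lemma Ck_on_subset: "Ck_on k S f \<Longrightarrow> T \<subseteq> S \<Longrightarrow> Ck_on k T f"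
  by (induction k arbitrary: f) (auto intro: continuous_on_subset)

text \<open>Openness makes derivatives at points of the set depend only on the values in the set.\<close>

lemma Ck_on_cong:
  assumes "open S" "\<And>p. p \<in> S \<Longrightarrow> f p = g p" "Ck_on k S g"
  shows "Ck_on k S f"
  using assms(2,3)
proof (induction k arbitrary: f g)
  case 0
  then show ?case by (simp cong: continuous_on_cong)
next
  case (Suc k)
  have D: "(f has_derivative frechet_derivative g (at p)) (at p)" if "p \<in> S" for p
    by (rule has_derivative_transform_within_open[OF _ assms(1) that])
       (use Suc.prems that in \<open>auto simp: frechet_derivative_works\<close>)
  then have E: "frechet_derivative f (at p) = frechet_derivative g (at p)" if "p \<in> S" for p
    using frechet_derivative_at that by force
  have "Ck_on k S (\<lambda>p. frechet_derivative f (at p) w)" for w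
    by (rule Suc.IH[where g="\<lambda>p. frechet_derivative g (at p) w"])
       (use E Suc.prems(2) in auto)
  then show ?case
    using D by (auto simp: differentiable_def)
qed

text \<open>The form in which explicit derivatives, instead of \<open>frechet_derivative\<close>, can be fed to an
  induction on the order of smoothness.\<close>

lemma Ck_on_SucI:
  assumes "open S" "\<And>p. p \<in> S \<Longrightarrow> (f has_derivative f' p) (at p)"
    and "\<And>w. Ck_on k S (\<lambda>p. f' p w)"
  shows "Ck_on (Suc k) S f"
proof -
  have "frechet_derivative f (at p) = f' p" if "p \<in> S" for p
    using frechet_derivative_at assms(2) that by metis
  then have "Ck_on k S (\<lambda>p. frechet_derivative f (at p) w)" for w
    using Ck_on_cong[OF assms(1) _ assms(3)[of w]] by simp
  then show ?thesis
    using assms(2) by (auto simp: differentiable_def)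
qed

lemma Ck_on_SucD:
  assumes "Ck_on (Suc k) S f"
  shows "Ck_on k S f"
  using assms
proof (induction k arbitrary: f)
  case 0
  then show ?case
    by (auto intro!: continuous_at_imp_continuous_on differentiable_imp_continuous_within)
qed auto

lemma Ck_on_const: "open S \<Longrightarrow> Ck_on k S (\<lambda>p. c)"
proof (induction k arbitrary: c)
  case (Suc k)
  then show ?case by (intro Ck_on_SucI[where f'="\<lambda>p w. 0"]) auto
qed auto

lemma Ck_on_linear:
  assumes "open S" "bounded_linear f"
  shows "Ck_on k S f"
proof (cases k)
  case 0
  then show ?thesis
    using linear_continuous_on[OF assms(2)] by simp
next
  case (Suc n)
  then show ?thesis
    using Ck_on_SucI[where f'="\<lambda>p. f", OF assms(1)] assms
    by (simp add: Ck_on_const bounded_linear_imp_has_derivative del: Ck_on.simps)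
qed

lemma Ck_on_add:
  assumes "open S" "Ck_on k S f" "Ck_on k S g"
  shows "Ck_on k S (\<lambda>p. f p + g p)"
  using assms(2,3)
proof (induction k arbitrary: f g)
  case (Suc k)
  then show ?case
    by (intro Ck_on_SucI[OF assms(1), where
          f'="\<lambda>p w. frechet_derivative f (at p) w + frechet_derivative g (at p) w"])
       (auto intro!: has_derivative_add simp: frechet_derivative_works)
qed (auto intro: continuous_on_add)

lemma Ck_on_scaleR:
  fixes f :: "'a::real_normed_vector \<Rightarrow> real"
  assumes "open S" "Ck_on k S f" "Ck_on k S g"
  shows "Ck_on k S (\<lambda>p. f p *\<^sub>R g p)"
  using assms(2,3)
proof (induction k arbitrary: f g)
  case (Suc k)
  show ?case
  proof (rule Ck_on_SucI[OF assms(1), where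
        f'="\<lambda>p w. f p *\<^sub>R frechet_derivative g (at p) w + frechet_derivative f (at p) w *\<^sub>R g p"])
    fix p assume "p \<in> S"
    then show "((\<lambda>p. f p *\<^sub>R g p) has_derivative
        (\<lambda>w. f p *\<^sub>R frechet_derivative g (at p) w + frechet_derivative f (at p) w *\<^sub>R g p)) (at p)"
      using Suc.prems by (intro has_derivative_scaleR) (auto simp: frechet_derivative_works)
  next
    fix w
    show "Ck_on k S (\<lambda>p. f p *\<^sub>R frechet_derivative g (at p) w + frechet_derivative f (at p) w *\<^sub>R g p)"
      using Suc.prems Ck_on_SucD[OF Suc.prems(1)] Ck_on_SucD[OF Suc.prems(2)]
      by (intro Ck_on_add assms Suc.IH) auto
  qed
qed (auto intro: continuous_on_scaleR)

lemma smooth_on_differentiable: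
  assumes "smooth_on S f" "p \<in> S"
  shows "(f has_derivative frechet_derivative f (at p)) (at p)"
  using assms(1)[unfolded smooth_on_def, rule_format, of 1] assms(2)
  by (simp add: frechet_derivative_works)

lemma smooth_on_imp_continuous_on: "smooth_on S f \<Longrightarrow> continuous_on S f"
  by (metis Ck_on.simps(1) smooth_on_def)

lemma has_derivative_partials:
  assumes "smooth_on S F" "q \<in> S"
  shows "(F has_derivative (\<lambda>w. fst w *\<^sub>R partial_u F q + snd w *\<^sub>R partial_v F q)) (at q)"
proof -
  let ?D = "frechet_derivative F (at q)"
  have D: "(F has_derivative ?D) (at q)" by (rule smooth_on_differentiable[OF assms])
  then have L: "linear ?D" by (rule has_derivative_linear)
  have "?D w = fst w *\<^sub>R partial_u F q + snd w *\<^sub>R partial_v F q" for w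
  proof -
    have "w = fst w *\<^sub>R coord_vec 1 + snd w *\<^sub>R coord_vec 2"
      by (simp add: coord_vec_def prod_eq_iff)
    then have "?D w = ?D (fst w *\<^sub>R coord_vec 1 + snd w *\<^sub>R coord_vec 2)" by simp
    then show ?thesis by (simp only: linear_add[OF L] linear_cmul[OF L] partial_deriv_def)
  qed
  then have "?D = (\<lambda>w. fst w *\<^sub>R partial_u F q + snd w *\<^sub>R partial_v F q)" by (rule ext)
  with D show ?thesis by (rule has_derivative_eq_rhs)
qed

lemma partials_of_has_derivative:
  assumes "(F has_derivative F') (at q)"
  shows "partial_u F q = F' (1, 0)" "partial_v F q = F' (0, 1)"
  using frechet_derivative_at[OF assms] by (simp_all add: partial_deriv_def coord_vec_def)

lemma partial_deriv_locally_const: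
  assumes "open V" "q \<in> V" "\<And>p. p \<in> V \<Longrightarrow> F p = c"
  shows "partial_deriv i F q = 0"
proof -
  have "(F has_derivative (\<lambda>w. 0)) (at q)"
    by (rule has_derivative_transform_within_open[OF _ assms(1,2)])
       (use assms(3) in \<open>auto intro: has_derivative_const\<close>)
  then show ?thesis
    using frechet_derivative_at by (metis partial_deriv_def)
qed

lemma constant_along_u:
  fixes F :: "real \<times> real \<Rightarrow> 'b::real_normed_vector"
  assumes "convex V" and D: "\<And>q. q \<in> V \<Longrightarrow> (F has_derivative F' q) (at q)"
    and Z: "\<And>q. q \<in> V \<Longrightarrow> F' q (1, 0) = 0"
    and V: "(u, v) \<in> V" "(u', v) \<in> V"
  shows "F (u, v) = F (u', v)"
proof -
  have cx: "convex {s. (s, v) \<in> V}"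
  proof (rule convexI)
    fix s t a b :: real
    assume "s \<in> {s. (s, v) \<in> V}" "t \<in> {s. (s, v) \<in> V}" "0 \<le> a" "0 \<le> b" and ab: "a + b = 1"
    then have "a *\<^sub>R (s, v) + b *\<^sub>R (t, v) \<in> V"
      using convexD[OF assms(1)] by blast
    moreover have "a * v + b * v = v" using ab by (metis distrib_right mult_1)
    ultimately show "a *\<^sub>R s + b *\<^sub>R t \<in> {s. (s, v) \<in> V}" by simp
  qed
  have "((\<lambda>s. F (s, v)) has_derivative (\<lambda>h. 0)) (at s within {s. (s, v) \<in> V})"
    if "s \<in> {s. (s, v) \<in> V}" for s
  proof -
    have d: "(F has_derivative F' (s, v)) (at (s, v))" using that D by simp
    have "((\<lambda>s. F (s, v)) has_derivative (\<lambda>h. F' (s, v) (h, 0))) (at s within {s. (s, v) \<in> V})"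
      by (rule has_derivative_compose[OF has_derivative_Pair[OF has_derivative_ident has_derivative_const] d])
    moreover have "F' (s, v) (h, 0) = 0" for h
      using linear_cmul[OF has_derivative_linear[OF d], of h "(1, 0)"] Z that by simp
    ultimately show ?thesis by simp
  qed
  from has_derivative_zero_unique[OF cx this, of u u'] V show ?thesis by simp
qed

section \<open>Local solvability of Lipschitz ordinary differential equations\<close>

text \<open>The integral operator of the initial value problem contracts the bounded continuous functions with
  factor \<open>L * d\<close>. It acts on functions on the whole line, by clamping the argument to the interval, so
  that the contraction principle applies to a complete space that is a type. Estimating differences
  with the mean value inequality treats both sides of \<open>t0\<close> at once.\<close>

lemma picard_lindeloef:
  fixes F :: "real \<Rightarrow> 'a::banach \<Rightarrow> 'a"
  assumes "0 \<le> d" "0 \<le> L" "L * d < 1"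
    and cont: "continuous_on ({t0 - d..t0 + d} \<times> UNIV) (\<lambda>(t, y). F t y)"
    and lip: "\<And>t y z. t \<in> {t0 - d..t0 + d} \<Longrightarrow> norm (F t y - F t z) \<le> L * norm (y - z)"
  obtains y where "y t0 = y0"
    "\<And>t. t \<in> {t0 - d..t0 + d} \<Longrightarrow> (y has_vector_derivative F t (y t)) (at t within {t0 - d..t0 + d})"
proof -
  define I where "I = {t0 - d..t0 + d}"
  have t0: "t0 \<in> I" using \<open>0 \<le> d\<close> by (simp add: I_def)
  define P where "P g t = y0 + integral {t0 - d..t} (\<lambda>s. F s (apply_bcontfun g s))
      - integral {t0 - d..t0} (\<lambda>s. F s (apply_bcontfun g s))" for g t
  have cF: "continuous_on I (\<lambda>s. F s (apply_bcontfun g s))" for g :: "real \<Rightarrow>\<^sub>C 'a"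
  proof -
    have "continuous_on I (\<lambda>s. (s, apply_bcontfun g s))"
      by (intro continuous_on_Pair continuous_on_id continuous_on_apply_bcontfun)
    then show ?thesis
      using continuous_on_compose2[OF cont, of I "\<lambda>s. (s, apply_bcontfun g s)"]
      by (auto simp: I_def)
  qed
  have dP: "(P g has_vector_derivative F t (apply_bcontfun g t)) (at t within I)" if "t \<in> I" for g t
  proof -
    have "((\<lambda>t. integral {t0 - d..t} (\<lambda>s. F s (apply_bcontfun g s)))
        has_vector_derivative F t (apply_bcontfun g t)) (at t within I)"
      unfolding I_def
      by (rule integral_has_vector_derivative[OF cF[unfolded I_def] that[unfolded I_def]])
    from has_vector_derivative_diff[OF has_vector_derivative_add[OF has_vector_derivative_const this]
        has_vector_derivative_const]
    show ?thesis by (simp add: P_def[abs_def])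
  qed
  have P0: "P g t0 = y0" for g by (simp add: P_def)
  have cP: "continuous_on I (P g)" for g
    using dP has_vector_derivative_continuous continuous_on_eq_continuous_within by blast
  have "\<exists>h. \<forall>t. apply_bcontfun h t = P g (clamp (t0 - d) (t0 + d) t)" for g
    using cP[of g, unfolded I_def, folded cbox_interval] by (rule continuous_on_cbox_bcontfunE) metis
  then obtain T where T: "apply_bcontfun (T g) t = P g (clamp (t0 - d) (t0 + d) t)" for g t
    by metis
  have cl: "clamp (t0 - d) (t0 + d) t \<in> I" for t :: real
    using clamp_in_interval[of "t0 - d" "t0 + d" t] \<open>0 \<le> d\<close> by (simp add: I_def)
  have "dist (T g) (T h) \<le> L * d * dist g h" for g h
  proof (rule dist_bound)
    fix t
    define s where "s = clamp (t0 - d) (t0 + d) t"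
    have s: "s \<in> I" unfolding s_def by (rule cl)
    have "norm ((P g s - P h s) - (P g t0 - P h t0)) \<le> L * dist g h * norm (s - t0)"
    proof (rule differentiable_bound[where S=I and f="\<lambda>s. P g s - P h s" and
          f'="\<lambda>s r. r *\<^sub>R (F s (apply_bcontfun g s) - F s (apply_bcontfun h s))"])
      fix r assume r: "r \<in> I"
      show "((\<lambda>s. P g s - P h s) has_derivative
          (\<lambda>a. a *\<^sub>R (F r (apply_bcontfun g r) - F r (apply_bcontfun h r)))) (at r within I)"
        using has_vector_derivative_diff[OF dP[OF r] dP[OF r]] by (simp add: has_vector_derivative_def)
      have "norm (F r (apply_bcontfun g r) - F r (apply_bcontfun h r)) \<le> L * dist g h"
        using lip[OF r[unfolded I_def]] mult_left_mono[OF dist_bounded[of g r h] \<open>0 \<le> L\<close>]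
        unfolding dist_norm[of "apply_bcontfun g r"] by (rule order_trans)
      then show "onorm (\<lambda>a::real. a *\<^sub>R (F r (apply_bcontfun g r) - F r (apply_bcontfun h r))) \<le> L * dist g h"
        by (intro onorm_le) (simp add: mult.commute mult_left_mono)
    qed (use s t0 in \<open>auto simp: I_def\<close>)
    also have "\<dots> \<le> L * dist g h * d"
      using s \<open>0 \<le> L\<close> by (intro mult_left_mono) (auto simp: I_def abs_le_iff)
    finally show "dist (apply_bcontfun (T g) t) (apply_bcontfun (T h) t) \<le> L * d * dist g h"
      by (simp add: T P0 s_def dist_norm mult_ac)
  qed
  with banach_fix_type[of "L * d" T] assms obtain g where g: "T g = g" by auto
  have gP: "apply_bcontfun g t = P g t" if "t \<in> I" for t
    using T[of g t] g that by (simp add: I_def)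
  show thesis
  proof (rule that)
    show "apply_bcontfun g t0 = y0" using gP[OF t0] P0 by simp
    fix t assume t: "t \<in> {t0 - d..t0 + d}"
    show "(apply_bcontfun g has_vector_derivative F t (apply_bcontfun g t)) (at t within {t0 - d..t0 + d})"
      by (rule has_vector_derivative_transform[OF t _ dP[unfolded I_def, OF t]])
         (use gP in \<open>auto simp: I_def\<close>)
  qed
qed

section \<open>The volume form\<close>

lemma dV_eq_dot_cross: "dV a b c = a \<bullet> cross3 b c"
  by (simp add: dV_def dot_cross_det)

lemma dV_expand:
  "dV a b c = a$1 * b$2 * c$3 + a$2 * b$3 * c$1 + a$3 * b$1 * c$2
            - a$1 * b$3 * c$2 - a$2 * b$1 * c$3 - a$3 * b$2 * c$1"
  by (simp add: dV_def det_3)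

lemma dV_linear:
  "dV (a + a') b c = dV a b c + dV a' b c" "dV a (b + b') c = dV a b c + dV a b' c"
  "dV a b (c + c') = dV a b c + dV a b c'"
  "dV (a - a') b c = dV a b c - dV a' b c" "dV a (b - b') c = dV a b c - dV a b' c"
  "dV a b (c - c') = dV a b c - dV a b c'"
  "dV (r *\<^sub>R a) b c = r * dV a b c" "dV a (r *\<^sub>R b) c = r * dV a b c" "dV a b (r *\<^sub>R c) = r * dV a b c"
  "dV 0 b c = 0" "dV a 0 c = 0" "dV a b 0 = 0"
  by (simp_all add: dV_expand algebra_simps)

lemma dV_repeated: "dV a a b = 0" "dV a b a = 0" "dV b a a = 0"
  by (simp_all add: dV_expand)

lemma dV_swap: "dV b a c = - dV a b c" "dV a c b = - dV a b c" "dV c b a = - dV a b c"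
  by (simp_all add: dV_expand)

lemma dV_matrix: "dV (A *v a) (A *v b) (A *v c) = det A * dV a b c"
proof -
  have "dV (A *v a) (A *v b) (A *v c) = a \<bullet> (transpose A *v cross3 (A *v b) (A *v c))"
    by (metis dV_eq_dot_cross dot_lmul_matrix inner_commute transpose_matrix_vector)
  also have "\<dots> = det A * dV a b c"
    by (simp add: cross_matrix_mult dV_eq_dot_cross del: transpose_matrix_vector)
  finally show ?thesis .
qed

lemma has_derivative_dV:
  assumes "(a has_derivative a') (at q within S)" "(b has_derivative b') (at q within S)"
    "(c has_derivative c') (at q within S)"
  shows "((\<lambda>p. dV (a p) (b p) (c p)) has_derivative
    (\<lambda>w. dV (a' w) (b q) (c q) + dV (a q) (b' w) (c q) + dV (a q) (b q) (c' w))) (at q within S)"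
proof -
  note nth = bounded_linear.has_derivative[OF bounded_linear_vec_nth]
  show ?thesis
    unfolding dV_expand
    by (rule derivative_eq_intros nth assms refl)+ (auto simp: algebra_simps)
qed

section \<open>Solutions as moving frames\<close>

text \<open>The system in terms of total derivatives, to which the calculus rules apply directly. It asks for
  differentiability only; if \<open>l\<close> and \<open>f\<close> are smooth on an open \<open>V\<close>, smoothness follows, and the
  formulation is equivalent to \<open>solution_on\<close> (see \<open>solution_on_iff\<close>).\<close>

definition structure_eqs :: "(real \<Rightarrow> real) \<Rightarrow> (real \<Rightarrow> real) \<Rightarrow> (real \<times> real) set
    \<Rightarrow> (real \<times> real \<Rightarrow> real^3) \<Rightarrow> (3 \<Rightarrow> real \<times> real \<Rightarrow> real^3) \<Rightarrow> bool" where
  "structure_eqs l f V x e \<longleftrightarrow> (\<forall>q\<in>V. unimodular_at e q \<and>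
     (x has_derivative (\<lambda>w. fst w *\<^sub>R e 1 q + snd w *\<^sub>R e 2 q)) (at q) \<and>
     (e 1 has_derivative (\<lambda>w. snd w *\<^sub>R e 3 q)) (at q) \<and>
     (e 2 has_derivative (\<lambda>w. fst w *\<^sub>R e 3 q + snd w *\<^sub>R (fst q * l (snd q) + f (snd q)) *\<^sub>R e 1 q)) (at q) \<and>
     (e 3 has_derivative (\<lambda>w. snd w *\<^sub>R l (snd q) *\<^sub>R e 1 q)) (at q))"

locale moving_frame =
  fixes l f V x e
  assumes eqs: "structure_eqs l f V x e"
begin

lemma unimodular: "q \<in> V \<Longrightarrow> dV (e 1 q) (e 2 q) (e 3 q) = 1"
  and dx: "q \<in> V \<Longrightarrow> (x has_derivative (\<lambda>w. fst w *\<^sub>R e 1 q + snd w *\<^sub>R e 2 q)) (at q)"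
  and de1: "q \<in> V \<Longrightarrow> (e 1 has_derivative (\<lambda>w. snd w *\<^sub>R e 3 q)) (at q)"
  and de2: "q \<in> V \<Longrightarrow> (e 2 has_derivative
    (\<lambda>w. fst w *\<^sub>R e 3 q + snd w *\<^sub>R (fst q * l (snd q) + f (snd q)) *\<^sub>R e 1 q)) (at q)"
  and de3: "q \<in> V \<Longrightarrow> (e 3 has_derivative (\<lambda>w. snd w *\<^sub>R l (snd q) *\<^sub>R e 1 q)) (at q)"
  using eqs by (auto simp: structure_eqs_def unimodular_at_def)

text \<open>By Cramer's rule: the coordinates are the determinants in which the vector replaces a frame vector,
  and the frame has determinant 1.\<close>

lemma frame_coords_combination:
  assumes "q \<in> V"
  shows "frame_coords e q (a *\<^sub>R e 1 q + b *\<^sub>R e 2 q + c *\<^sub>R e 3 q) = vector [a, b, c]"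
  unfolding frame_coords_def
proof (rule the_equality)
  fix y :: "real^3"
  assume y: "a *\<^sub>R e 1 q + b *\<^sub>R e 2 q + c *\<^sub>R e 3 q = (\<Sum>i\<in>UNIV. (y $ i) *\<^sub>R e i q)" (is "?l = ?r")
  have "dV ?l (e 2 q) (e 3 q) = dV ?r (e 2 q) (e 3 q)" "dV (e 1 q) ?l (e 3 q) = dV (e 1 q) ?r (e 3 q)"
    "dV (e 1 q) (e 2 q) ?l = dV (e 1 q) (e 2 q) ?r" unfolding y by rule+
  then show "y = vector [a, b, c]"
    using unimodular[OF assms] by (simp add: sum_3 dV_linear dV_repeated vec_eq_iff forall_3)
qed (simp add: sum_3)

lemma dual_form_eq:
  assumes "q \<in> V"
  shows "dual_form x e 1 q w = fst w" "dual_form x e 2 q w = snd w"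
  using frame_coords_combination[OF assms, of "fst w" "snd w" 0]
  by (simp_all add: dual_form_def frechet_derivative_at[OF dx[OF assms], symmetric])

lemma conn_form_eq:
  assumes "q \<in> V"
  shows "conn_form e 3 1 q w = snd w" "conn_form e 3 2 q w = fst w" "conn_form e 3 3 q w = 0"
    "conn_form e 1 3 q w = snd w * l (snd q)" "conn_form e 2 3 q w = 0"
  using frame_coords_combination[OF assms, of 0 0 "snd w"]
    frame_coords_combination[OF assms, of "snd w * (fst q * l (snd q) + f (snd q))" 0 "fst w"]
    frame_coords_combination[OF assms, of "snd w * l (snd q)" 0 0]
  by (simp_all add: conn_form_def frechet_derivative_at[OF de1[OF assms], symmetric] add.commute
      frechet_derivative_at[OF de2[OF assms], symmetric] frechet_derivative_at[OF de3[OF assms], symmetric])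

lemma h_matrix_eq:
  assumes "q \<in> V"
  shows "h_matrix x e q = vector [vector [0, 1], vector [1, 0]]"
  unfolding h_matrix_def dual_form_eq[OF assms] conn_form_eq[OF assms]
proof (rule the_equality)
  fix h :: "real^2^2"
  assume *: "\<forall>w::real \<times> real. snd w = h$1$1 * fst w + h$1$2 * snd w \<and> fst w = h$2$1 * fst w + h$2$2 * snd w"
  show "h = vector [vector [0, 1], vector [1, 0]]"
    using *[rule_format, of "(1, 0)"] *[rule_format, of "(0, 1)"]
    by (simp add: vec_eq_iff forall_2)
qed simp

lemma H_aff_eq:
  assumes "q \<in> V"
  shows "H_aff x e q = 0"
  unfolding H_aff_def dual_form_eq[OF assms] conn_form_eq[OF assms]
proof (rule the_equality)
  show "\<exists>l11 l22. \<forall>w::real \<times> real. snd w * l (snd q) = 0 * fst w + l22 * snd w \<and> 0 = l11 * fst w + 0 * snd w"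
    by (rule exI[of _ 0], rule exI[of _ "l (snd q)"]) simp
next
  fix m
  assume "\<exists>l11 l22. \<forall>w::real \<times> real. snd w * l (snd q) = m * fst w + l22 * snd w \<and> 0 = l11 * fst w + m * snd w"
  then obtain l11 where "\<forall>w::real \<times> real. 0 = l11 * fst w + m * snd w" by blast
  from this[rule_format, of "(0, 1)"] show "m = 0" by simp
qed

lemma I_aff_eq:
  assumes "q \<in> V"
  shows "I_aff x e q w z = fst w * snd z + snd w * fst z"
  by (simp add: I_aff_def sym_prod_def dual_form_eq[OF assms] conn_form_eq[OF assms] algebra_simps)

text \<open>The metric has constant coefficients in the coordinates \<open>(u, v)\<close>, so all Christoffel symbols vanish.\<close>

lemma K_aff_eq:
  assumes "open V" "q \<in> V"
  shows "K_aff x e q = 0"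
proof -
  let ?g = "\<lambda>q. (\<chi> i j. I_aff x e q (coord_vec i) (coord_vec j)) :: real^2^2"
  have "partial_deriv i (\<lambda>p. ?g p $ j $ m) p = 0" if "p \<in> V" for i j m p
    by (rule partial_deriv_locally_const[OF assms(1) that]) (simp add: I_aff_eq)
  then have c: "christoffel ?g k i j p = 0" if "p \<in> V" for k i j p
    using that by (simp add: christoffel_def)
  have "partial_deriv m (christoffel ?g k i j) q = 0" for m k i j
    by (rule partial_deriv_locally_const[OF assms]) (rule c)
  then have "curv_vec ?g k q = 0" for k
    using assms(2) by (simp add: curv_vec_def c)
  then show ?thesis by (simp add: K_aff_def gauss_curvature_def)
qed

lemma inj_dx: "q \<in> V \<Longrightarrow> inj (frechet_derivative x (at q))"
proof (rule injI)
  fix w z assume q: "q \<in> V" and "frechet_derivative x (at q) w = frechet_derivative x (at q) z"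
  then have "dual_form x e 1 q w = dual_form x e 1 q z" "dual_form x e 2 q w = dual_form x e 2 q z"
    by (simp_all add: dual_form_def)
  with q show "w = z" by (simp add: dual_form_eq prod_eq_iff)
qed

lemma range_dx:
  assumes "q \<in> V"
  shows "span {e 1 q, e 2 q} = range (frechet_derivative x (at q))"
proof -
  have "span {e 1 q, e 2 q} = range (\<lambda>w. fst w *\<^sub>R e 1 q + snd w *\<^sub>R e 2 q)"
  proof (intro equalityI subsetI)
    fix y assume "y \<in> span {e 1 q, e 2 q}"
    then obtain a b where "y - a *\<^sub>R e 1 q = b *\<^sub>R e 2 q"
      by (auto simp: span_breakdown_eq span_singleton)
    then have "y = fst (a, b) *\<^sub>R e 1 q + snd (a, b) *\<^sub>R e 2 q"
      by (simp add: algebra_simps)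
    then show "y \<in> range (\<lambda>w. fst w *\<^sub>R e 1 q + snd w *\<^sub>R e 2 q)" by blast
  next
    fix y assume "y \<in> range (\<lambda>w. fst w *\<^sub>R e 1 q + snd w *\<^sub>R e 2 q)"
    then obtain w where y: "y = fst w *\<^sub>R e 1 q + snd w *\<^sub>R e 2 q" by blast
    show "y \<in> span {e 1 q, e 2 q}"
      unfolding y by (intro span_add span_scale span_base) simp_all
  qed
  then show ?thesis unfolding frechet_derivative_at[OF dx[OF assms], symmetric] .
qed

text \<open>Bootstrapping: the derivatives of the frame are products of the frame with smooth coefficients, so
  each order of smoothness yields the next.\<close>

lemma smooth:
  assumes "open V" and l: "smooth_on V (\<lambda>q. l (snd q))" and f: "smooth_on V (\<lambda>q. f (snd q))"
  shows "smooth_on V x" "smooth_on V (e i)"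
proof -
  note I = Ck_on_add[OF assms(1)] Ck_on_scaleR[OF assms(1)] Ck_on_const[OF assms(1)]
  have lk: "Ck_on k V (\<lambda>q. l (snd q))" "Ck_on k V (\<lambda>q. f (snd q))" "Ck_on k V fst" for k
    using l f Ck_on_linear[OF assms(1) bounded_linear_fst] by (auto simp: smooth_on_def)
  have "Ck_on k V (\<lambda>q. fst q *\<^sub>R l (snd q) + f (snd q))" for k by (intro I lk)
  then have ck: "Ck_on k V (\<lambda>q. fst q * l (snd q) + f (snd q))" for k by simp
  have ek: "Ck_on k V (e 1) \<and> Ck_on k V (e 2) \<and> Ck_on k V (e 3)" for k
  proof (induction k)
    case 0
    show ?case
      using de1 de2 de3 by (auto intro!: has_derivative_continuous continuous_at_imp_continuous_on)
  next
    case (Suc k)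
    then show ?case
      by (auto intro!: Ck_on_SucI[OF assms(1) de1] Ck_on_SucI[OF assms(1) de2]
          Ck_on_SucI[OF assms(1) de3] I lk ck simp del: Ck_on.simps)
  qed
  then show "smooth_on V (e i)" using exhaust_3[of i] by (auto simp: smooth_on_def)
  have "Ck_on (Suc k) V x" for k
    using ek by (auto intro!: Ck_on_SucI[OF assms(1) dx] I simp del: Ck_on.simps)
  then show "smooth_on V x" using Ck_on_SucD by (auto simp: smooth_on_def simp del: Ck_on.simps)
qed

end

lemma solution_on_iff:
  assumes "open V" "smooth_on V (\<lambda>q. l (snd q))" "smooth_on V (\<lambda>q. f (snd q))"
  shows "solution_on l f V x e \<longleftrightarrow> structure_eqs l f V x e"
proof
  assume s: "solution_on l f V x e"
  show "structure_eqs l f V x e"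
    unfolding structure_eqs_def
  proof (safe)
    fix u v assume q: "(u, v) \<in> V"
    have D: "(x has_derivative (\<lambda>w. fst w *\<^sub>R partial_u x (u, v) + snd w *\<^sub>R partial_v x (u, v))) (at (u, v))"
      "(e i has_derivative (\<lambda>w. fst w *\<^sub>R partial_u (e i) (u, v) + snd w *\<^sub>R partial_v (e i) (u, v))) (at (u, v))" for i
      by (rule has_derivative_partials[OF _ q], use s in \<open>simp add: solution_on_def\<close>)+
    show "unimodular_at e (u, v)" using s q by (simp add: solution_on_def)
    show "(x has_derivative (\<lambda>w. fst w *\<^sub>R e 1 (u, v) + snd w *\<^sub>R e 2 (u, v))) (at (u, v))"
      "(e 1 has_derivative (\<lambda>w. snd w *\<^sub>R e 3 (u, v))) (at (u, v))"
      "(e 2 has_derivative (\<lambda>w. fst w *\<^sub>R e 3 (u, v) + snd w *\<^sub>R (fst (u, v) * l (snd (u, v)) + f (snd (u, v))) *\<^sub>R e 1 (u, v))) (at (u, v))"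
      "(e 3 has_derivative (\<lambda>w. snd w *\<^sub>R l (snd (u, v)) *\<^sub>R e 1 (u, v))) (at (u, v))"
      using D(1) D(2)[of 1] D(2)[of 2] D(2)[of 3] s q by (simp_all add: solution_on_def)
  qed
next
  assume s: "structure_eqs l f V x e"
  then interpret moving_frame l f V x e by unfold_locales
  show "solution_on l f V x e"
    using smooth[OF assms] s
    by (auto simp: solution_on_def structure_eqs_def partials_of_has_derivative[OF dx]
        partials_of_has_derivative[OF de1] partials_of_has_derivative[OF de2]
        partials_of_has_derivative[OF de3])
qed

section \<open>Global shape and invariants of the surface\<close>

context moving_frame
begin

text \<open>Only \<open>e\<^sub>1\<close> and \<open>e\<^sub>3\<close> occur, and each has its derivative along the other; the plane that they span,
  with its area, therefore stays fixed.\<close>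

lemma constant_conormal:
  assumes "open V" "connected V" "q \<in> V" "q' \<in> V"
  shows "dV (e 1 q) y (e 3 q) = dV (e 1 q') y (e 3 q')"
proof (rule has_derivative_zero_unique_connected[OF assms(1,2) _ assms(3,4), where f="\<lambda>q. dV (e 1 q) y (e 3 q)"])
  fix q assume q: "q \<in> V"
  show "((\<lambda>q. dV (e 1 q) y (e 3 q)) has_derivative (\<lambda>w. 0)) (at q)"
    by (rule has_derivative_eq_rhs[OF has_derivative_dV[OF de1[OF q] has_derivative_const de3[OF q]]])
       (simp add: dV_linear dV_repeated)
qed

text \<open>The conormal annihilates \<open>e\<^sub>1 = x\<^sub>u\<close> and takes the value 1 on \<open>e\<^sub>2 = x\<^sub>v\<close>, so along the surface it is
  \<open>v\<close> up to a constant.\<close>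

lemma conormal_height:
  assumes "open V" "connected V" "q0 \<in> V" "q \<in> V"
  shows "dV (e 1 q0) (x q) (e 3 q0) - snd q = dV (e 1 q0) (x q0) (e 3 q0) - snd q0"
proof (rule has_derivative_zero_unique_connected[OF assms(1,2) _ assms(4,3),
      where f="\<lambda>q. dV (e 1 q0) (x q) (e 3 q0) - snd q"])
  fix q assume q: "q \<in> V"
  have *: "dV (e 1 q0) y (e 3 q0) = dV (e 1 q) y (e 3 q)" for y
    by (rule constant_conormal[OF assms(1-3) q])
  show "((\<lambda>q. dV (e 1 q0) (x q) (e 3 q0) - snd q) has_derivative (\<lambda>w. 0)) (at q)"
    unfolding *
    by (rule has_derivative_eq_rhs[OF has_derivative_diff[OF has_derivative_dV[OF has_derivative_const
          dx[OF q] has_derivative_const] has_derivative_snd[OF has_derivative_ident]]])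
       (simp add: dV_linear dV_repeated unimodular[OF q])
qed

text \<open>Since \<open>e\<^sub>1 = x\<^sub>u\<close> is constant along \<open>u\<close>, the parameter lines of \<open>u\<close> are straight lines.\<close>

lemma ruled:
  assumes "convex V" "(u, v) \<in> V" "(u', v) \<in> V"
  shows "x (u, v) = x (u', v) + (u - u') *\<^sub>R e 1 (u', v)"
proof -
  have e: "e 1 (u, v) = e 1 (u', v)"
    by (rule constant_along_u[OF assms(1) de1 _ assms(2,3)]) auto
  have "x (u, v) - fst (u, v) *\<^sub>R e 1 (u, v) = x (u', v) - fst (u', v) *\<^sub>R e 1 (u', v)"
    by (rule constant_along_u[where F="\<lambda>q. x q - fst q *\<^sub>R e 1 q", OF assms(1)
          has_derivative_diff[OF dx has_derivative_scaleR[OF has_derivative_fst[OF has_derivative_ident] de1]] _ assms(2,3)])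
       auto
  then show ?thesis by (simp add: e algebra_simps)
qed

text \<open>The inverse is explicit. The height \<open>s\<close> over the constant conormal recovers \<open>v\<close>. Among the points of
  the ruling through \<open>x (u0, v)\<close>, the coefficient of \<open>e\<^sub>1\<close> in \<open>y - x (u0, v)\<close>, which is a determinant,
  recovers \<open>u - u0\<close>. The product shape of \<open>V\<close> guarantees that \<open>(u0, v)\<close> lies in \<open>V\<close>.\<close>

lemma homeomorphism_onto_image:
  assumes "open I" "open J" "convex I" "convex J" and V: "V = I \<times> J"
  shows "\<exists>Y. homeomorphism V (x ` V) x Y"
proof (cases "V = {}")
  case True
  then show ?thesis by (simp add: homeomorphism_empty)
next
  case False
  then obtain u0 v0 where q0: "(u0, v0) \<in> V" by auto
  have oc: "open V" "convex V" "connected V"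
    using assms by (auto simp: open_Times convex_Times convex_connected)
  define s where "s y = dV (e 1 (u0, v0)) (y - x (u0, v0)) (e 3 (u0, v0)) + v0" for y
  define Y where "Y y = (u0 + dV (y - x (u0, s y)) (e 2 (u0, s y)) (e 3 (u0, s y)), s y)" for y
  have s: "s (x (u, v)) = v" if "(u, v) \<in> V" for u v
    using conormal_height[OF oc(1,3) q0 that] by (simp add: s_def dV_linear)
  have Y: "Y (x q) = q" if "q \<in> V" for q
  proof (cases q)
    case (Pair u v)
    then have uv: "(u, v) \<in> V" and u0v: "(u0, v) \<in> V" using that q0 V by auto
    have "x (u, v) - x (u0, v) = (u - u0) *\<^sub>R e 1 (u0, v)"
      using ruled[OF oc(2) uv u0v] by simp
    then show ?thesis
      by (simp add: Y_def Pair s[OF uv] dV_linear(7) unimodular[OF u0v])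
  qed
  have cs: "continuous_on A s" for A
    unfolding s_def dV_expand by (intro continuous_intros)
  have sub: "(\<lambda>y. (u0, s y)) ` (x ` V) \<subseteq> V" using s q0 V by auto
  have cc: "continuous_on (x ` V) (\<lambda>y. F (u0, s y))" if "continuous_on V F" for F :: "_ \<Rightarrow> real^3"
    by (rule continuous_on_compose2[OF that _ sub]) (intro continuous_intros cs)
  have c: "continuous_on V x" "continuous_on V (e 2)" "continuous_on V (e 3)"
    using dx de2 de3 by (auto intro!: has_derivative_continuous continuous_at_imp_continuous_on)
  have "continuous_on (x ` V) Y"
    unfolding Y_def dV_expand by (intro continuous_intros cs cc c)
  then have "homeomorphism V (x ` V) x Y"
    using Y c(1) by (auto simp: homeomorphism_def image_image)
  then show ?thesis by blast
qed

end

text \<open>The solution itself serves at every point as local parametrization and as 2-adapted frame field.\<close>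

lemma affine_surface_of_solution:
  assumes "open I" "open J" "convex I" "convex J" and V: "V = I \<times> J"
    and "smooth_on V x" "\<And>i. smooth_on V (e i)" and "structure_eqs l f V x e"
  shows "parametrization (x ` V) V x" "hyperbolic_surface (x ` V)" "affine_flat (x ` V)" "affine_minimal (x ` V)"
proof -
  interpret moving_frame l f V x e using assms by unfold_locales
  have "open V" using assms by (simp add: open_Times)
  obtain Y where Y: "homeomorphism V (x ` V) x Y"
    using homeomorphism_onto_image[OF assms(1-5)] by blast
  then have inj: "inj_on x V" by (metis homeomorphism_apply1 inj_on_inverseI)
  have im: "immersion_on V x" using assms(6) inj_dx by (simp add: immersion_on_def)
  have lp: "local_param (x ` V) V x"
    using \<open>open V\<close> im Y by (auto simp: local_param_def)
  then have reg: "regular_surface (x ` V)" by (auto simp: regular_surface_def)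
  have "Ck_on k V (inv_into V x \<circ> x)" for k
    by (rule Ck_on_cong[OF \<open>open V\<close> _ Ck_on_linear[OF \<open>open V\<close> bounded_linear_ident]])
       (simp add: inj)
  then have "smooth_on_surface (x ` V) (inv_into V x)"
    using lp by (auto simp: smooth_on_surface_def smooth_on_def)
  with reg \<open>open V\<close> im inj show "parametrization (x ` V) V x"
    by (simp add: parametrization_def bij_betw_def)
  have a0: "zero_adapted V x e"
    using assms(7) unimodular range_dx by (simp add: zero_adapted_def unimodular_at_def)
  then have a1: "one_adapted V x e" by (simp add: one_adapted_def h_matrix_eq)
  then have a2: "two_adapted V x e" by (simp add: two_adapted_def conn_form_eq)
  show "hyperbolic_surface (x ` V)"
    unfolding hyperbolic_surface_def
    using reg lp a0 by (auto simp: h_matrix_eq det_2 intro!: exI[of _ V] exI[of _ x] exI[of _ e])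
  show "affine_flat (x ` V)"
    unfolding affine_flat_def
    using lp a1 K_aff_eq[OF \<open>open V\<close>] by (auto intro!: exI[of _ V] exI[of _ x] exI[of _ e])
  show "affine_minimal (x ` V)"
    unfolding affine_minimal_def
    using lp a2 by (auto simp: H_aff_eq intro!: exI[of _ V] exI[of _ x] exI[of _ e])
qed

section \<open>Uniqueness up to equiaffine transformations\<close>

text \<open>With the frames as columns of matrices \<open>F\<close> and \<open>F'\<close>, the map \<open>M q\<close> is \<open>F' (inverse F)\<close> at \<open>q\<close>, with the
  inverse written by Cramer's rule. From \<open>dF = F \<Omega>\<close> and \<open>dF' = F' \<Omega>\<close> with the same \<open>\<Omega>\<close> its derivative
  is \<open>F' \<Omega> (inverse F) - F' (inverse F) F \<Omega> (inverse F) = 0\<close>.\<close>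

lemma congruent:
  assumes "open V" "connected V" "structure_eqs l f V x e" "structure_eqs l f V x' e'"
  shows "\<exists>\<phi>. equiaffine \<phi> \<and> (\<forall>q\<in>V. x' q = \<phi> (x q))"
proof (cases "V = {}")
  case True
  have "equiaffine id" unfolding equiaffine_def
    by (rule exI[of _ "mat 1"], rule exI[of _ 0]) simp
  with True show ?thesis by auto
next
  case False
  then obtain q0 where q0: "q0 \<in> V" by auto
  interpret s: moving_frame l f V x e using assms by unfold_locales
  interpret s': moving_frame l f V x' e' using assms by unfold_locales
  define M where "M q y = dV y (e 2 q) (e 3 q) *\<^sub>R e' 1 q + dV (e 1 q) y (e 3 q) *\<^sub>R e' 2 q
      + dV (e 1 q) (e 2 q) y *\<^sub>R e' 3 q" for q y
  have M: "M q y = M q0 y" if "q \<in> V" for q y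
  proof (rule has_derivative_zero_unique_connected[OF assms(1,2) _ that q0, where f="\<lambda>q. M q y"])
    fix q assume q: "q \<in> V"
    note d = s.de1[OF q] s.de2[OF q] s.de3[OF q] s'.de1[OF q] s'.de2[OF q] s'.de3[OF q]
    have sw: "dV y (e 1 q) (e 3 q) = - dV (e 1 q) y (e 3 q)" "dV (e 1 q) (e 3 q) y = - dV (e 1 q) y (e 3 q)"
      "dV y (e 2 q) (e 1 q) = - dV (e 1 q) (e 2 q) y" "dV (e 3 q) (e 2 q) y = - dV y (e 2 q) (e 3 q)"
      by (rule dV_swap)+
    show "((\<lambda>q. M q y) has_derivative (\<lambda>w. 0)) (at q)"
      unfolding M_def
      by (rule has_derivative_eq_rhs, (rule has_derivative_add has_derivative_scaleR has_derivative_dV d has_derivative_const)+)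
         (simp add: dV_linear dV_repeated sw algebra_simps)
  qed
  have "linear (M q0)"
    by (rule linearI) (simp_all add: M_def dV_linear algebra_simps)
  then have A: "matrix (M q0) *v y = M q0 y" for y
    by (simp add: matrix_works)
  define A where "A = matrix (M q0)"
  have Ae: "A *v e 1 q = e' 1 q" "A *v e 2 q = e' 2 q" "A *v e 3 q = e' 3 q" if "q \<in> V" for q
    using that by (simp_all add: A_def A M[OF that, symmetric]) (simp_all add: M_def dV_repeated s.unimodular)
  have "det A = 1"
    using dV_matrix[of A "e 1 q0" "e 2 q0" "e 3 q0"] s.unimodular[OF q0] s'.unimodular[OF q0] Ae[OF q0] by simp
  moreover have "x' q - A *v x q = x' q0 - A *v x q0" if "q \<in> V" for q
  proof (rule has_derivative_zero_unique_connected[OF assms(1,2) _ that q0, where f="\<lambda>q. x' q - A *v x q"])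
    fix q assume q: "q \<in> V"
    show "((\<lambda>q. x' q - A *v x q) has_derivative (\<lambda>w. 0)) (at q)"
      by (rule has_derivative_eq_rhs[OF has_derivative_diff[OF s'.dx[OF q]
            bounded_linear.has_derivative[OF matrix_vector_mul_bounded_linear s.dx[OF q]]]])
         (simp add: matrix_vector_right_distrib matrix_vector_mult_scaleR Ae[OF q])
  qed
  then have "\<forall>q\<in>V. x' q = A *v x q + (x' q0 - A *v x q0)"
    by (metis add.commute diff_add_cancel)
  ultimately show ?thesis
    unfolding equiaffine_def by (intro exI[of _ "\<lambda>y. A *v y + (x' q0 - A *v x q0)"]) blast
qed

section \<open>Existence of moving frames\<close>

text \<open>The ansatz \<open>x = g(v) + u p(v)\<close> forces \<open>e\<^sub>1 = p\<close>, \<open>e\<^sub>2 = g' + u p'\<close>, \<open>e\<^sub>3 = p'\<close>. Writing \<open>h = g'\<close> and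
  \<open>q = p'\<close>, the remaining equations become \<open>h' = f p\<close> and \<open>q' = l p\<close>, one first-order linear system
  for \<open>(g, p, h, q)\<close>. The initial values are the standard frame at \<open>v0\<close>.\<close>

lemma moving_frame_exists:
  assumes "r > 0" "continuous_on {v0 - r..v0 + r} l" "continuous_on {v0 - r..v0 + r} f"
  obtains d x e where "0 < d" "d \<le> r" "structure_eqs l f (UNIV \<times> {v0 - d<..<v0 + d}) x e"
proof -
  have "bounded (l ` {v0 - r..v0 + r} \<union> f ` {v0 - r..v0 + r})"
    using assms by (auto intro!: compact_imp_bounded compact_continuous_image)
  then obtain M where M: "M > 0" "\<And>t. t \<in> {v0 - r..v0 + r} \<Longrightarrow> \<bar>l t\<bar> \<le> M \<and> \<bar>f t\<bar> \<le> M"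
    unfolding bounded_pos by auto
  \<comment> \<open>A Lipschitz constant: two components are copied, two are multiplied by at most \<open>M\<close>.\<close>
  define L where "L = 2 + 2 * M"
  define d where "d = min r (1 / (2 * L))"
  have L: "L > 0" using M by (simp add: L_def)
  have d: "0 < d" "d \<le> r" "L * d < 1"
  proof -
    show "0 < d" "d \<le> r" using assms(1) L by (auto simp: d_def)
    have "L * d \<le> L * (1 / (2 * L))" using L by (intro mult_left_mono) (auto simp: d_def)
    then show "L * d < 1" using L by simp
  qed
  define F :: "real \<Rightarrow> (real^3) \<times> (real^3) \<times> (real^3) \<times> (real^3) \<Rightarrow> (real^3) \<times> (real^3) \<times> (real^3) \<times> (real^3)"
    where "F t = (\<lambda>(g, p, h, q). (h, q, f t *\<^sub>R p, l t *\<^sub>R p))" for t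
  have sub: "{v0 - d..v0 + d} \<subseteq> {v0 - r..v0 + r}" using d by auto
  have lc: "continuous_on ({v0 - d..v0 + d} \<times> UNIV) (\<lambda>z. l (fst z))"
       "continuous_on ({v0 - d..v0 + d} \<times> UNIV) (\<lambda>z. f (fst z))"
    using sub by (auto intro!: continuous_on_compose2[OF assms(2)] continuous_on_compose2[OF assms(3)] continuous_intros)
  have cont: "continuous_on ({v0 - d..v0 + d} \<times> UNIV) (\<lambda>(t, y). F t y)"
    unfolding F_def case_prod_beta by (intro continuous_intros lc)
  have lip: "norm (F t y - F t z) \<le> L * norm (y - z)" if t: "t \<in> {v0 - d..v0 + d}" for t y z
  proof -
    obtain g p h q where yz: "y - z = (g, p, h, q)" by (cases "y - z")
    have 1: "F t y - F t z = (h, q, f t *\<^sub>R p, l t *\<^sub>R p)"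
      using yz by (cases y, cases z) (auto simp: F_def scaleR_diff_right[symmetric])
    have n: "norm p \<le> norm (y - z)" "norm h \<le> norm (y - z)" "norm q \<le> norm (y - z)"
      unfolding yz by (meson norm_fst_le norm_snd_le order_trans)+
    have "norm (F t y - F t z) \<le> norm h + (norm q + (norm (f t *\<^sub>R p) + norm (l t *\<^sub>R p)))"
      unfolding 1 by (intro order_trans[OF norm_Pair_le] add_left_mono order_refl)
    moreover have "norm (f t *\<^sub>R p) \<le> M * norm (y - z)" "norm (l t *\<^sub>R p) \<le> M * norm (y - z)"
      using M t sub n by (auto intro!: mult_mono)
    ultimately show ?thesis using n by (simp add: L_def algebra_simps)
  qed
  obtain y where y0: "y v0 = (0, axis 1 1, axis 2 1, axis 3 1)" and
    y: "\<And>t. t \<in> {v0 - d..v0 + d} \<Longrightarrow> (y has_vector_derivative F t (y t)) (at t within {v0 - d..v0 + d})"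
    using picard_lindeloef[OF _ _ d(3) cont lip] d L by (metis less_imp_le)
  define g p h q where "g t = fst (y t)" and "p t = fst (snd (y t))" and "h t = fst (snd (snd (y t)))"
    and "q t = snd (snd (snd (y t)))" for t
  let ?J = "{v0 - d<..<v0 + d}"
  have D: "(g has_derivative (\<lambda>s. s *\<^sub>R h t)) (at t)" "(p has_derivative (\<lambda>s. s *\<^sub>R q t)) (at t)"
    "(h has_derivative (\<lambda>s. s *\<^sub>R f t *\<^sub>R p t)) (at t)" "(q has_derivative (\<lambda>s. s *\<^sub>R l t *\<^sub>R p t)) (at t)"
    if t: "t \<in> ?J" for t
  proof -
    have "(y has_vector_derivative F t (y t)) (at t)"
      using y[of t] t at_within_interior[of t "{v0 - d..v0 + d}"] by simp
    then have "(y has_derivative (\<lambda>s. s *\<^sub>R F t (y t))) (at t)" by (simp add: has_vector_derivative_def)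
    note D = has_derivative_fst[OF this] has_derivative_fst[OF has_derivative_snd[OF this]]
      has_derivative_fst[OF has_derivative_snd[OF has_derivative_snd[OF this]]]
      has_derivative_snd[OF has_derivative_snd[OF has_derivative_snd[OF this]]]
    show "(g has_derivative (\<lambda>s. s *\<^sub>R h t)) (at t)" "(p has_derivative (\<lambda>s. s *\<^sub>R q t)) (at t)"
      "(h has_derivative (\<lambda>s. s *\<^sub>R f t *\<^sub>R p t)) (at t)" "(q has_derivative (\<lambda>s. s *\<^sub>R l t *\<^sub>R p t)) (at t)"
      using D by (simp_all add: g_def[abs_def] p_def[abs_def] h_def[abs_def] q_def[abs_def] F_def case_prod_beta)
  qed
  \<comment> \<open>Each derivative repeats another column of the determinant, so the determinant is conserved.\<close>
  have vol: "dV (p t) (h t) (q t) = 1" if t: "t \<in> ?J" for t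
  proof -
    have "dV (p t) (h t) (q t) = dV (p v0) (h v0) (q v0)"
    proof (rule has_derivative_zero_unique_connected[where s="?J" and f="\<lambda>t. dV (p t) (h t) (q t)"])
      fix t assume t: "t \<in> ?J"
      show "((\<lambda>t. dV (p t) (h t) (q t)) has_derivative (\<lambda>s. 0)) (at t)"
        by (rule has_derivative_eq_rhs[OF has_derivative_dV[OF D(2)[OF t] D(3)[OF t] D(4)[OF t]]])
           (simp add: dV_linear dV_repeated)
    qed (use t d in auto)
    also have "\<dots> = 1" by (simp add: g_def p_def h_def q_def y0 dV_expand axis_def)
    finally show ?thesis .
  qed
  define x where "x z = g (snd z) + fst z *\<^sub>R p (snd z)" for z :: "real \<times> real"
  define e :: "3 \<Rightarrow> real \<times> real \<Rightarrow> real^3" where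
    "e i = (if i = 1 then \<lambda>z. p (snd z) else if i = 2 then \<lambda>z. h (snd z) + fst z *\<^sub>R q (snd z)
      else (\<lambda>z. q (snd z)))" for i
  have e: "e 1 = (\<lambda>z. p (snd z))" "e 2 = (\<lambda>z. h (snd z) + fst z *\<^sub>R q (snd z))" "e 3 = (\<lambda>z. q (snd z))"
    by (simp_all add: e_def)
  have "structure_eqs l f (UNIV \<times> ?J) x e"
    unfolding structure_eqs_def
  proof (intro ballI conjI)
    fix z assume "z \<in> (UNIV :: real set) \<times> ?J"
    then have t: "snd z \<in> ?J" by auto
    note S = has_derivative_compose[OF has_derivative_snd[OF has_derivative_ident]]
    note D' = S[OF D(1)[OF t]] S[OF D(2)[OF t]] S[OF D(3)[OF t]] S[OF D(4)[OF t]]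
      has_derivative_fst[OF has_derivative_ident]
    show "unimodular_at e z"
      using vol[OF t] by (simp add: unimodular_at_def e dV_linear dV_repeated)
    show "(x has_derivative (\<lambda>w. fst w *\<^sub>R e 1 z + snd w *\<^sub>R e 2 z)) (at z)"
      unfolding x_def[abs_def] e
      by (rule has_derivative_eq_rhs, (rule has_derivative_add has_derivative_scaleR D')+) (simp add: algebra_simps)
    show "(e 1 has_derivative (\<lambda>w. snd w *\<^sub>R e 3 z)) (at z)"
      "(e 3 has_derivative (\<lambda>w. snd w *\<^sub>R l (snd z) *\<^sub>R e 1 z)) (at z)"
      unfolding e by (rule D')+
    show "(e 2 has_derivative (\<lambda>w. fst w *\<^sub>R e 3 z + snd w *\<^sub>R (fst z * l (snd z) + f (snd z)) *\<^sub>R e 1 z)) (at z)"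
      unfolding e
      by (rule has_derivative_eq_rhs, (rule has_derivative_add has_derivative_scaleR D')+) (simp add: algebra_simps)
  qed
  with d show thesis by (intro that)
qed

section \<open>Local existence and rigidity of the surfaces\<close>

theorem theorem4p1:
  fixes U :: "(real \<times> real) set" and l f :: "real \<Rightarrow> real" and u0 v0 :: real
  assumes "open U"
    and "smooth_on U (\<lambda>(u, v). l v)"
    and "smooth_on U (\<lambda>(u, v). f v)"
    and "(u0, v0) \<in> U"
  shows "\<exists>V. open V \<and> connected V \<and> (u0, v0) \<in> V \<and> V \<subseteq> U
    \<and> (\<exists>x e. solution_on l f V x e)
    \<and> (\<forall>x e. solution_on l f V x e \<longrightarrow>
          parametrization (x ` V) V x \<and> hyperbolic_surface (x ` V)
          \<and> affine_flat (x ` V) \<and> affine_minimal (x ` V))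
    \<and> (\<forall>x e x' e'. solution_on l f V x e \<and> solution_on l f V x' e' \<longrightarrow>
          (\<exists>\<phi>. equiaffine \<phi> \<and> x' ` V = \<phi> ` (x ` V)))"
proof -
  obtain A B where "open A" "open B" and AB: "(u0, v0) \<in> A \<times> B" "A \<times> B \<subseteq> U"
    by (rule open_prod_elim[OF assms(1,4)])
  obtain a where a: "a > 0" "ball u0 a \<subseteq> A" using \<open>open A\<close> AB(1) by (auto simp: open_contains_ball)
  obtain r where r: "r > 0" "cball v0 r \<subseteq> B" using \<open>open B\<close> AB(1) by (auto simp: open_contains_cball)
  have rB: "{v0 - r..v0 + r} \<subseteq> B" using r by (simp add: cball_eq_atLeastAtMost)
  have sub: "(\<lambda>v. (u0, v)) ` {v0 - r..v0 + r} \<subseteq> U" using rB AB by auto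
  have "continuous_on {v0 - r..v0 + r} l" "continuous_on {v0 - r..v0 + r} f"
    using continuous_on_compose2[OF smooth_on_imp_continuous_on[OF assms(2)] _ sub]
      continuous_on_compose2[OF smooth_on_imp_continuous_on[OF assms(3)] _ sub]
    by (simp_all add: continuous_intros)
  then obtain d x e where d: "0 < d" "d \<le> r" and xe: "structure_eqs l f (UNIV \<times> {v0 - d<..<v0 + d}) x e"
    using moving_frame_exists[OF r(1)] by metis
  \<comment> \<open>Shrinking the second factor to the interval of solvability leaves the domain a box inside \<open>U\<close>.\<close>
  define J where "J = {v0 - d<..<v0 + d}"
  define V where "V = ball u0 a \<times> J"
  have J: "open J" "convex J" "J \<subseteq> B" using d rB by (auto simp: J_def)
  have V: "open V" "connected V" "(u0, v0) \<in> V" "V \<subseteq> U"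
    unfolding V_def using J a AB d
    by (auto simp: open_Times convex_Times convex_connected J_def)
  have lf: "smooth_on V (\<lambda>q. l (snd q))" "smooth_on V (\<lambda>q. f (snd q))"
    using assms(2,3) by (auto simp: smooth_on_def case_prod_beta' intro: Ck_on_subset[OF _ V(4)])
  note sol = solution_on_iff[OF V(1) lf]
  have "structure_eqs l f V x e"
    using xe by (auto simp: structure_eqs_def V_def J_def)
  then have "\<exists>x e. solution_on l f V x e" by (auto simp: sol)
  moreover have "parametrization (x ` V) V x \<and> hyperbolic_surface (x ` V)
      \<and> affine_flat (x ` V) \<and> affine_minimal (x ` V)" if "solution_on l f V x e" for x e
  proof -
    have sm: "smooth_on V x" "\<And>i. smooth_on V (e i)"
      using that by (simp_all add: solution_on_def)
    have "structure_eqs l f V x e" using that by (simp add: sol)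
    from affine_surface_of_solution[OF open_ball J(1) convex_ball J(2) V_def sm this]
    show ?thesis by blast
  qed
  moreover have "\<exists>\<phi>. equiaffine \<phi> \<and> x' ` V = \<phi> ` (x ` V)"
    if "solution_on l f V x e" "solution_on l f V x' e'" for x e x' e'
  proof -
    have "structure_eqs l f V x e" "structure_eqs l f V x' e'" using that by (simp_all add: sol)
    from congruent[OF V(1,2) this] obtain \<phi> where \<phi>: "equiaffine \<phi>" "\<forall>q\<in>V. x' q = \<phi> (x q)"
      by blast
    have "x' ` V = \<phi> ` (x ` V)" unfolding image_image by (rule image_cong) (use \<phi> in auto)
    with \<phi>(1) show ?thesis by blast
  qed
  ultimately show ?thesis
    using V by (intro exI[of _ V] conjI allI impI) blast+
qed

end
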